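(* Let $p$ be an odd prime and let $q\in\mathbb{C}_p$ with $|1-q|_p<1$. For every $n\in\mathbb{N}=\{1,2,3,\dots\}$, $$q\,E_{n,q}(2)=2+\frac{1}{q}E_{n,q}.$$
   Context: $\mathbb{C}_p$ denotes the completion of an algebraic closure of $\mathbb{Q}_p$. For $q\in\mathbb{C}_p$ with $|1-q|_p<1$, the $q$-Euler numbers $E_{n,q}$ and $q$-Euler polynomials $E_{n,q}(x)$ are defined by the generating functions (formal power series in $t$) $$\frac{2}{qe^t+1}=\sum_{n=0}^{\infty}E_{n,q}\frac{t^n}{n!},\qquad \frac{2}{qe^t+1}e^{xt}=\sum_{n=0}^{\infty}E_{n,q}(x)\frac{t^n}{n!},$$ so that $E_{n,q}(x)=\sum_{l=0}^{n}\binom{n}{l}x^{n-l}E_{l,q}$. *)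

theory Defs
  imports "HOL-Analysis.Analysis" "HOL-Computational_Algebra.Computational_Algebra"
begin

class nonarch_valued_field = field_char_0 + metric_space +
  fixes vabs :: "'a \<Rightarrow> real"
  assumes dist_vabs: "dist x y = vabs (x - y)"
    and vabs_mult: "vabs (x * y) = vabs x * vabs y"
    and vabs_ultrametric: "vabs (x + y) \<le> max (vabs x) (vabs y)"

definition padic_abs :: "nat \<Rightarrow> rat \<Rightarrow> real" where
  "padic_abs p r =
     (if r = 0 then 0
      else real p powi (int (multiplicity (int p) (snd (quotient_of r)))
                        - int (multiplicity (int p) (fst (quotient_of r)))))"

definition is_subfield :: "'a::field set \<Rightarrow> bool" where
  "is_subfield K \<longleftrightarrow>
     0 \<in> K \<and> 1 \<in> K \<and>
     (\<forall>x\<in>K. \<forall>y\<in>K. x + y \<in> K \<and> x * y \<in> K) \<and>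
     (\<forall>x\<in>K. - x \<in> K \<and> inverse x \<in> K)"

text \<open>\<open>K\<close> is a copy of $\mathbb{Q}_p$: a completion of $\mathbb{Q}$ for the $p$-adic
  absolute value.\<close>

definition is_padic_numbers :: "nat \<Rightarrow> 'a::nonarch_valued_field set \<Rightarrow> bool" where
  "is_padic_numbers p K \<longleftrightarrow>
     is_subfield K \<and>
     (\<forall>r::rat. vabs (of_rat r :: 'a) = padic_abs p r) \<and>
     complete K \<and> K \<subseteq> closure \<rat>"

definition is_algebraic_closure :: "'a::field set \<Rightarrow> 'a set \<Rightarrow> bool" where
  "is_algebraic_closure K L \<longleftrightarrow>
     is_subfield L \<and> K \<subseteq> L \<and>
     (\<forall>x\<in>L. \<exists>f. f \<noteq> 0 \<and> (\<forall>i. coeff f i \<in> K) \<and> poly f x = 0) \<and>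
     (\<forall>f. degree f > 0 \<and> (\<forall>i. coeff f i \<in> L) \<longrightarrow> (\<exists>x\<in>L. poly f x = 0))"

text \<open>The valued field \<open>'a\<close> is a copy of $\mathbb{C}_p$, which is determined only up to
  isometric isomorphism; \<open>vabs\<close> on it is the absolute value normalised by $|p|_p = 1/p$.\<close>

definition is_Cp :: "nat \<Rightarrow> 'a::nonarch_valued_field itself \<Rightarrow> bool" where
  "is_Cp p T \<longleftrightarrow>
     complete (UNIV :: 'a set) \<and>
     (\<exists>K L :: 'a set. is_padic_numbers p K \<and> is_algebraic_closure K L \<and> closure L = UNIV)"

text \<open>The divisor has constant coefficient \<open>q + 1\<close>, so it is a unit unless \<open>q = -1\<close>; in that
  case \<open>/\<close> does not compute the (Laurent) quotient.\<close>

definition q_euler_gf :: "'a::field_char_0 \<Rightarrow> 'a fps" where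
  "q_euler_gf q = 2 / (fps_const q * fps_exp 1 + 1)"

definition q_euler_number :: "nat \<Rightarrow> 'a::field_char_0 \<Rightarrow> 'a" where
  "q_euler_number n q = fact n * fps_nth (q_euler_gf q) n"

definition q_euler_poly :: "nat \<Rightarrow> 'a::field_char_0 \<Rightarrow> 'a \<Rightarrow> 'a" where
  "q_euler_poly n q x = fact n * fps_nth (q_euler_gf q * fps_exp x) n"

end

theory Submission imports Defs begin

text \<open>Multiplying \<open>G (q e\<^sup>t + 1) = 2\<close> by \<open>q e\<^sup>t - 1\<close> gives
  \<open>q\<^sup>2 e\<^sup>2\<^sup>t G = G + 2 q e\<^sup>t - 2\<close>; comparing coefficients of \<open>t\<^sup>n\<close> with \<open>n > 0\<close> and dividing
  by \<open>q\<close> yields the claim. The hypotheses on \<open>p\<close> and \<open>q\<close> only serve to exclude \<open>q = 0\<close> and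
  \<open>q = -1\<close>: both \<open>1\<close> and, as \<open>p\<close> is odd, \<open>2\<close> have \<open>p\<close>-adic absolute value \<open>1\<close>.\<close>

lemma q_euler_gf_mult:
  fixes q :: "'a::field_char_0"
  assumes "q \<noteq> -1"
  shows "q_euler_gf q * (fps_const q * fps_exp 1 + 1) = 2"
proof -
  have "fps_nth (fps_const q * fps_exp 1 + 1) 0 \<noteq> 0"
    using assms by (simp add: add_eq_0_iff2)
  then show ?thesis
    unfolding q_euler_gf_def
    by (simp add: fps_divide_unit mult.assoc inverse_mult_eq_1)
qed

lemma q_euler_gf_mult_exp_2:
  fixes q :: "'a::field_char_0"
  assumes "q \<noteq> -1"
  shows "fps_const (q\<^sup>2) * (q_euler_gf q * fps_exp 2)
    = q_euler_gf q + fps_const (2 * q) * fps_exp 1 - 2"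
proof -
  let ?G = "q_euler_gf q" and ?A = "fps_const q * fps_exp 1"
  have sq: "?A * ?A = fps_const (q\<^sup>2) * fps_exp 2"
    using fps_exp_add_mult [of 1 "1::'a"]
    by (simp add: power2_eq_square mult.assoc mult.left_commute flip: fps_const_mult)
  \<comment> \<open>A difference of squares: the factor \<open>?A - 1\<close> brings in
    \<open>?A * ?A\<close> and hence \<open>fps_exp 2\<close>.\<close>
  have "?G * (?A * ?A) - ?G = (?G * (?A + 1)) * (?A - 1)"
    by (simp add: algebra_simps)
  also have "\<dots> = 2 * (?A - 1)"
    by (simp only: q_euler_gf_mult [OF assms])
  also have "\<dots> = fps_const (2 * q) * fps_exp 1 - 2"
    by (rule fps_ext) (simp add: numeral_fps_const right_diff_distrib)
  finally show ?thesis
    unfolding sq by (simp add: algebra_simps)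
qed

lemma q_euler_poly_2:
  fixes q :: "'a::field_char_0"
  assumes "q \<noteq> -1" and "n \<ge> 1"
  shows "q\<^sup>2 * q_euler_poly n q 2 = q_euler_number n q + 2 * q"
proof -
  \<comment> \<open>As \<open>n \<ge> 1\<close>, the constant \<open>2\<close> drops out;
    \<open>fps_exp 1\<close> gives \<open>1 / fact n\<close>, which the factor \<open>fact n\<close>
    clears.\<close>
  have "q\<^sup>2 * fps_nth (q_euler_gf q * fps_exp 2) n
      = fps_nth (q_euler_gf q) n + 2 * q / fact n"
    using arg_cong [OF q_euler_gf_mult_exp_2 [OF assms(1)], of "\<lambda>f. fps_nth f n"] assms(2)
    by (simp add: numeral_fps_const del: fps_const_mult fps_const_power)
  then show ?thesis
    unfolding q_euler_poly_def q_euler_number_def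
    by (simp add: field_simps)
qed

lemma padic_abs_1: "padic_abs p 1 = 1"
  by (simp add: padic_abs_def)

lemma padic_abs_2:
  assumes "prime p" and "odd p"
  shows "padic_abs p 2 = 1"
proof -
  \<comment> \<open>A prime dividing 2 is 2 itself, which is even.\<close>
  have "\<not> p dvd 2"
    using assms primes_dvd_imp_eq [of p 2] two_is_prime_nat by auto
  then have "\<not> int p dvd 2"
    using int_dvd_int_iff [of p 2] by simp
  moreover have "quotient_of 2 = (2, 1)"
    using quotient_of_int [of 2] by simp
  ultimately show ?thesis
    by (simp add: padic_abs_def not_dvd_imp_multiplicity_0)
qed

theorem theorem2:
  fixes p n :: nat and q :: "'a::nonarch_valued_field"
  assumes "prime p" and "odd p"
    and "is_Cp p TYPE('a)"
    and "vabs (1 - q) < 1"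
    and "n \<ge> 1"
  shows "q * q_euler_poly n q 2 = 2 + (1 / q) * q_euler_number n q"
proof -
  have vabs: "vabs (of_rat r :: 'a) = padic_abs p r" for r
    using assms(3) unfolding is_Cp_def is_padic_numbers_def by blast
  have "vabs (1 :: 'a) = 1" and "vabs (2 :: 'a) = 1"
    using vabs [of 1] vabs [of 2] padic_abs_1 padic_abs_2 [OF assms(1,2)] by simp_all
  \<comment> \<open>For \<open>q = 0\<close> and \<open>q = -1\<close>, \<open>1 - q\<close> would
    be \<open>1\<close> and \<open>2\<close>, both of absolute value 1.\<close>
  then have "q \<noteq> 0" and "q \<noteq> -1"
    using assms(4) by auto
  then show ?thesis
    using q_euler_poly_2 [of q n] assms(5)
    by (simp add: field_simps power2_eq_square)
qed

end
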